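(* Let $2 \leq m \leq n$ be integers and let $P_m, P_n$ denote the paths on $m$ and $n$ vertices. Then $\sigma(P_m \boxtimes P_n) = 5$ if $m \geq 4$; $\sigma(P_m \boxtimes P_n) = 4$ if $m = 3$, or if $m = 2$ and $n \geq 4$; and $\sigma(P_m \boxtimes P_n) = 3$ if $m = 2$ and $n \leq 3$.
   Context: Surrounding Cops and Robbers on a finite simple graph $G$ with $k \geq 1$ cops and one robber: the cops first choose starting vertices (several cops may share a vertex), then the robber chooses a starting vertex not occupied by a cop, and thereafter the cops and the robber alternate moves, the cops moving first. In a move, each player may move to an adjacent vertex or stay put; the robber may never move to, or remain on, a vertex occupied by a cop, so if a cop moves onto the robber's vertex the robber is compelled to move to a neighbouring vertex not occupied by a cop. The cops win if at any time every neighbour of the robber's vertex is occupied by a cop; the robber wins if he avoids this forever. Play is with perfect information. The surrounding cop number $\sigma(G)$ is the least number of cops for which the cops have a winning strategy. The strong product $G \boxtimes H$ has vertex set $V(G)\times V(H)$, with distinct $(g,h)$ and $(g',h')$ adjacent iff ($g=g'$ or $gg'\in E(G)$) and ($h=h'$ or $hh'\in E(H)$). *)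

theory Defs
  imports "Graph_Theory.Pair_Digraph"
begin

text \<open>
  A finite simple graph is a symmetric loop-free digraph without parallel arcs, that is, a
  member of the locale \<open>pair_graph\<close>; an edge $uv$ is the pair of arcs \<open>(u, v)\<close>, \<open>(v, u)\<close>.
\<close>

definition path_graph :: "nat \<Rightarrow> nat pair_pre_digraph" where
  "path_graph n = \<lparr>pverts = {0..<n},
     parcs = {(i, j). i < n \<and> j < n \<and> (j = Suc i \<or> i = Suc j)}\<rparr>"

definition strong_product ::
    "'a pair_pre_digraph \<Rightarrow> 'b pair_pre_digraph \<Rightarrow> ('a \<times> 'b) pair_pre_digraph"
    (infixl \<open>\<boxtimes>\<close> 70) where
  "G \<boxtimes> H = \<lparr>pverts = pverts G \<times> pverts H,
     parcs = {((g, h), (g', h')).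
       (g, h) \<in> pverts G \<times> pverts H \<and> (g', h') \<in> pverts G \<times> pverts H \<and>
       (g, h) \<noteq> (g', h') \<and>
       (g = g' \<or> (g, g') \<in> parcs G) \<and> (h = h' \<or> (h, h') \<in> parcs H)}\<rparr>"

lemma pair_graph_path_graph: "pair_graph (path_graph n)"
proof
  have "parcs (path_graph n) \<subseteq> {0..<n} \<times> {0..<n}"
    by (auto simp: path_graph_def)
  then show "finite (parcs (path_graph n))"
    by (rule finite_subset) simp
qed (auto simp: path_graph_def symmetric_def intro: symI)

lemma pair_graph_strong_product:
  assumes "pair_graph G" and "pair_graph H"
  shows "pair_graph (G \<boxtimes> H)"
proof -
  interpret G: pair_graph G by fact
  interpret H: pair_graph H by fact
  have "parcs (G \<boxtimes> H) \<subseteq> (pverts G \<times> pverts H) \<times> (pverts G \<times> pverts H)"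
    by (auto simp: strong_product_def)
  then have "finite (parcs (G \<boxtimes> H))"
    by (rule finite_subset) (simp add: G.pair_finite_verts H.pair_finite_verts)
  moreover have "sym (parcs (G \<boxtimes> H))"
    using G.pair_sym_arcs H.pair_sym_arcs
    by (auto simp: strong_product_def symmetric_def intro!: symI dest: symD)
  ultimately show ?thesis
    by unfold_locales
      (auto simp: strong_product_def symmetric_def G.pair_finite_verts H.pair_finite_verts)
qed

text \<open>The positions of the cops are the list of their vertices.\<close>

definition cop_positions :: "'a pair_pre_digraph \<Rightarrow> nat \<Rightarrow> 'a list set" where
  "cop_positions G k = {c. length c = k \<and> set c \<subseteq> pverts G}"

definition step :: "'a pair_pre_digraph \<Rightarrow> 'a \<Rightarrow> 'a \<Rightarrow> bool" where
  "step G u v \<longleftrightarrow> u = v \<or> (u, v) \<in> parcs G"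

definition cop_move :: "'a pair_pre_digraph \<Rightarrow> 'a list \<Rightarrow> 'a list \<Rightarrow> bool" where
  "cop_move G c c' \<longleftrightarrow> list_all2 (step G) c c'"

definition robber_move :: "'a pair_pre_digraph \<Rightarrow> 'a list \<Rightarrow> 'a \<Rightarrow> 'a \<Rightarrow> bool" where
  "robber_move G c r r' \<longleftrightarrow> step G r r' \<and> r' \<notin> set c"

definition surrounded :: "'a pair_pre_digraph \<Rightarrow> 'a list \<Rightarrow> 'a \<Rightarrow> bool" where
  "surrounded G c r \<longleftrightarrow> (\<forall>v. (r, v) \<in> parcs G \<longrightarrow> v \<in> set c)"

text \<open>
  A cop strategy assigns the next cop positions to the nonempty history of play, which lists the
  pairs (cop positions, robber vertex) after the placement and after each round.
\<close>

type_synonym 'a cop_strategy = "('a list \<times> 'a) list \<Rightarrow> 'a list"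

definition legal_strategy :: "'a pair_pre_digraph \<Rightarrow> nat \<Rightarrow> 'a cop_strategy \<Rightarrow> bool" where
  "legal_strategy G k s \<longleftrightarrow>
     (\<forall>h c r. c \<in> cop_positions G k \<longrightarrow> r \<in> pverts G \<longrightarrow> cop_move G c (s (h @ [(c, r)])))"

text \<open>
  \<open>C t\<close> and \<open>R t\<close> are the positions after \<open>t\<close> rounds, a round being a cop move from \<open>C t\<close> to
  \<open>C (Suc t)\<close> followed by a robber move from \<open>R t\<close> to \<open>R (Suc t)\<close>.
\<close>

definition play_against ::
    "'a pair_pre_digraph \<Rightarrow> 'a list \<Rightarrow> 'a cop_strategy \<Rightarrow> (nat \<Rightarrow> 'a list) \<Rightarrow> (nat \<Rightarrow> 'a) \<Rightarrow> bool" where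
  "play_against G c\<^sub>0 s C R \<longleftrightarrow>
     C 0 = c\<^sub>0 \<and> R 0 \<in> pverts G - set c\<^sub>0 \<and>
     (\<forall>t. C (Suc t) = s (map (\<lambda>i. (C i, R i)) [0..<Suc t])) \<and>
     (\<forall>t. robber_move G (C (Suc t)) (R t) (R (Suc t)))"

text \<open>
  The robber can be surrounded after his own move, \<open>(C t, R t)\<close>, or after a move of the cops,
  \<open>(C (Suc t), R t)\<close>. A robber who is not surrounded always has a legal move, so a play that
  cannot be continued has been won by the cops, and it suffices to consider infinite plays.
  A placement that leaves the robber no starting vertex counts as won by the cops.
\<close>

definition escapes :: "'a pair_pre_digraph \<Rightarrow> (nat \<Rightarrow> 'a list) \<Rightarrow> (nat \<Rightarrow> 'a) \<Rightarrow> bool" where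
  "escapes G C R \<longleftrightarrow>
     (\<forall>t. \<not> surrounded G (C t) (R t) \<and> \<not> surrounded G (C (Suc t)) (R t))"

definition winning_strategy ::
    "'a pair_pre_digraph \<Rightarrow> nat \<Rightarrow> 'a list \<Rightarrow> 'a cop_strategy \<Rightarrow> bool" where
  "winning_strategy G k c\<^sub>0 s \<longleftrightarrow>
     c\<^sub>0 \<in> cop_positions G k \<and> legal_strategy G k s \<and>
     (\<forall>C R. play_against G c\<^sub>0 s C R \<longrightarrow> \<not> escapes G C R)"

definition cops_win :: "'a pair_pre_digraph \<Rightarrow> nat \<Rightarrow> bool" where
  "cops_win G k \<longleftrightarrow> (\<exists>c\<^sub>0 s. winning_strategy G k c\<^sub>0 s)"

definition surrounding_cop_number :: "'a pair_pre_digraph \<Rightarrow> nat" (\<open>\<sigma>\<close>) where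
  "\<sigma> G = (LEAST k. 1 \<le> k \<and> cops_win G k)"

end

theory Submission
  imports Defs
begin

text \<open>
  Lower bounds: the robber stays inside a small set of vertices, each having more than \<open>k\<close>
  neighbours in the graph and, counting itself, more than \<open>k\<close> neighbours in the set; then \<open>k\<close>
  cops can neither surround him nor block all his moves inside the set.

  Upper bounds: a cop can chase any target that depends on the robber's vertex and moves by at most
  one in each coordinate whenever the robber does, and having reached it can follow it forever.
  With five cops at the offsets $(0,0)$, $(1,1)$, $(1,0)$, $(1,-1)$, $(0,1)$ from the robber,
  clamped to the grid, every move of the robber decreases his position lexicographically. In a grid
  with two columns the four cops on the rows $y$ and $y+1$ of the robber's row $y$ force him down.
  With three columns a barrier on row $y+1$ and one cop in the middle of row $y$ do the same.
\<close>

section \<open>The game\<close>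

lemma cop_move_refl: "cop_move G c c"
  by (simp add: cop_move_def step_def list.rel_refl)

lemma (in pair_graph) step_in_verts:
  assumes "u \<in> pverts G" and "step G u v"
  shows "v \<in> pverts G"
  using assms in_arcsD2 by (auto simp: step_def)

lemma (in pair_graph) cop_move_in_positions:
  assumes "c \<in> cop_positions G k" and "cop_move G c c'"
  shows "c' \<in> cop_positions G k"
proof -
  have "length c' = k"
    using assms by (simp add: cop_move_def cop_positions_def list_all2_lengthD[symmetric])
  moreover have "c' ! i \<in> pverts G" if "i < length c'" for i
  proof -
    have "step G (c ! i) (c' ! i)" "c ! i \<in> pverts G"
      using assms that by (auto simp: cop_move_def cop_positions_def list_all2_conv_all_nth)
    then show ?thesis
      by (blast intro: step_in_verts)
  qed
  ultimately show ?thesis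
    by (auto simp: cop_positions_def in_set_conv_nth)
qed

section \<open>A robber strategy from local vertex counts\<close>

lemma (in pair_graph) robber_escapes:
  assumes S: "S \<subseteq> pverts G" "S \<noteq> {}"
    and closed: "\<And>v. v \<in> S \<Longrightarrow> k < card {u \<in> S. step G v u}"
    and deg: "\<And>v. v \<in> S \<Longrightarrow> k < card {u. (v, u) \<in> parcs G}"
  shows "\<not> cops_win G k"
proof
  assume "cops_win G k"
  then obtain c\<^sub>0 s where c\<^sub>0: "c\<^sub>0 \<in> cop_positions G k" and legal: "legal_strategy G k s"
    and win: "\<And>C R. play_against G c\<^sub>0 s C R \<Longrightarrow> \<not> escapes G C R"
    by (auto simp: cops_win_def winning_strategy_def)
  have avoid: "\<exists>u\<in>A. u \<notin> set c" if "c \<in> cop_positions G k" "k < card A" for c and A :: "'a set"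
  proof (rule ccontr)
    assume "\<not> ?thesis"
    then have "card A \<le> card (set c)"
      by (intro card_mono) auto
    with that card_length[of c] show False
      by (simp add: cop_positions_def)
  qed
  have reply: "\<exists>r'\<in>S. robber_move G c r r'" if "c \<in> cop_positions G k" "r \<in> S" for c r
    using avoid[OF that(1) closed[OF that(2)]] by (auto simp: robber_move_def)
  obtain r\<^sub>0 where r\<^sub>0: "r\<^sub>0 \<in> S" "r\<^sub>0 \<notin> set c\<^sub>0"
    using S(2) reply[OF c\<^sub>0] by (auto simp: robber_move_def)
  define next_r where "next_r c r = (SOME r'. r' \<in> S \<and> robber_move G c r r')" for c r
  have next_r: "next_r c r \<in> S \<and> robber_move G c r (next_r c r)"
    if "c \<in> cop_positions G k" "r \<in> S" for c r
    unfolding next_r_def by (rule someI_ex) (use reply[OF that] in blast)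
  \<comment> \<open>A cop strategy reads the whole history, so the history itself is built by
    recursion; \<open>C\<close> and \<open>R\<close> are read off its last entry.\<close>
  define H where "H = rec_nat [(c\<^sub>0, r\<^sub>0)] (\<lambda>_ h. h @ [(s h, next_r (s h) (snd (last h)))])"
  define C where "C t = fst (last (H t))" for t
  define R where "R t = snd (last (H t))" for t
  have H_0: "H 0 = [(c\<^sub>0, r\<^sub>0)]" and H_Suc: "H (Suc t) = H t @ [(s (H t), next_r (s (H t)) (R t))]" for t
    by (simp_all add: H_def R_def)
  have C_Suc: "C (Suc t) = s (H t)" and R_Suc: "R (Suc t) = next_r (C (Suc t)) (R t)" for t
    by (simp_all add: C_def R_def H_Suc)
  have H_eq: "H t = map (\<lambda>i. (C i, R i)) [0..<Suc t]" for t
  proof (induction t)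
    case 0
    then show ?case by (simp add: C_def R_def H_0)
  next
    case (Suc t)
    have "H (Suc t) = H t @ [(C (Suc t), R (Suc t))]"
      by (simp add: C_Suc R_Suc H_Suc)
    then show ?case by (simp add: Suc)
  qed
  have C_move: "cop_move G (C t) (C (Suc t))" if "C t \<in> cop_positions G k" "R t \<in> S" for t
  proof -
    have "H t = map (\<lambda>i. (C i, R i)) [0..<t] @ [(C t, R t)]"
      by (simp add: H_eq)
    moreover have "R t \<in> pverts G"
      using S(1) that(2) by blast
    ultimately show ?thesis
      using legal that(1) unfolding legal_strategy_def C_Suc by simp
  qed
  have inv: "C t \<in> cop_positions G k \<and> R t \<in> S" for t
  proof (induction t)
    case 0
    then show ?case using c\<^sub>0 r\<^sub>0 by (simp add: C_def R_def H_0)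
  next
    case (Suc t)
    then have "C (Suc t) \<in> cop_positions G k"
      using C_move cop_move_in_positions by blast
    then show ?case
      using Suc next_r by (simp add: R_Suc)
  qed
  have "play_against G c\<^sub>0 s C R"
    unfolding play_against_def
  proof (intro conjI allI)
    show "C 0 = c\<^sub>0" "R 0 \<in> pverts G - set c\<^sub>0"
      using S r\<^sub>0 by (auto simp: C_def R_def H_0)
    show "C (Suc t) = s (map (\<lambda>i. (C i, R i)) [0..<Suc t])" for t
      using C_Suc H_eq by metis
    show "robber_move G (C (Suc t)) (R t) (R (Suc t))" for t
      using next_r inv by (simp add: R_Suc)
  qed
  moreover have "\<not> surrounded G (C t) (R t')" for t t'
    using avoid[OF _ deg] inv unfolding surrounded_def by blast
  then have "escapes G C R"
    by (simp add: escapes_def)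
  ultimately show False
    using win by blast
qed

section \<open>From won positions to a winning strategy\<close>

text \<open>Positions with the robber to move from which the cops can force a win.\<close>

inductive won :: "'a pair_pre_digraph \<Rightarrow> 'a list \<Rightarrow> 'a \<Rightarrow> bool" for G where
  surrounded: "surrounded G c r \<Longrightarrow> won G c r"
| reply: "(\<And>r'. robber_move G c r r' \<Longrightarrow> \<exists>c'. cop_move G c c' \<and> won G c' r') \<Longrightarrow> won G c r"

text \<open>The derivation behind \<open>won\<close> carries no number, and a strategy that merely
  stays among won positions could cycle. The bound on the remaining rounds is a rank that a strategy
  can decrease.\<close>

fun won_within :: "'a pair_pre_digraph \<Rightarrow> nat \<Rightarrow> 'a list \<Rightarrow> 'a \<Rightarrow> bool" where
  "won_within G 0 c r \<longleftrightarrow> surrounded G c r"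
| "won_within G (Suc k) c r \<longleftrightarrow> surrounded G c r \<or>
     (\<forall>r'. robber_move G c r r' \<longrightarrow> (\<exists>c'. cop_move G c c' \<and> won_within G k c' r'))"

lemma won_within_Suc: "won_within G k c r \<Longrightarrow> won_within G (Suc k) c r"
proof (induction k arbitrary: c r)
  case (Suc k)
  then show ?case
    by (metis won_within.simps(2))
qed simp

lemma won_within_mono: "k \<le> l \<Longrightarrow> won_within G k c r \<Longrightarrow> won_within G l c r"
  by (induction rule: dec_induct) (auto simp del: won_within.simps intro: won_within_Suc)

text \<open>The robber has only finitely many moves, so the bounds for his individual moves have a
  maximum, and the bounds are monotone.\<close>

lemma (in pair_graph) won_imp_won_within:
  assumes "won G c r"
  shows "\<exists>k. won_within G k c r"
  using assms
proof induction
  case (surrounded c r)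
  then show ?case by (metis won_within.simps(1))
next
  case (reply c r)
  let ?A = "{r'. robber_move G c r r'}"
  have "?A \<subseteq> insert r (snd ` parcs G)"
    by (force simp: robber_move_def step_def)
  then have fin: "finite ?A"
    by (rule finite_subset) simp
  obtain K where K: "\<And>r'. r' \<in> ?A \<Longrightarrow> \<exists>c'. cop_move G c c' \<and> won_within G (K r') c' r'"
    using reply by (metis mem_Collect_eq)
  have "\<exists>c'. cop_move G c c' \<and> won_within G (Max (K ` ?A)) c' r'" if r': "robber_move G c r r'" for r'
  proof -
    have le: "K r' \<le> Max (K ` ?A)"
      using fin r' by simp
    obtain c' where c': "cop_move G c c'" "won_within G (K r') c' r'"
      using K[of r'] r' by blast
    show ?thesis
      by (rule exI[of _ c'], rule conjI[OF c'(1)], rule won_within_mono[OF le c'(2)])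
  qed
  then have "won_within G (Suc (Max (K ` ?A))) c r"
    unfolding won_within.simps by blast
  then show ?case ..
qed

text \<open>The positional strategy that always minimises the rank wins: an escaping robber would
  give an infinite strictly decreasing sequence of ranks. The hypothesis mentions a cop move because
  the cops move first, while \<open>won\<close> has the robber to move.\<close>

lemma (in pair_graph) cops_winI:
  assumes c\<^sub>0: "c\<^sub>0 \<in> cop_positions G k"
    and won: "\<And>r. r \<in> pverts G - set c\<^sub>0 \<Longrightarrow> \<exists>c. cop_move G c\<^sub>0 c \<and> won G c r"
  shows "cops_win G k"
proof -
  define Q where "Q c r j c' \<longleftrightarrow> cop_move G c c' \<and> won_within G j c' r" for c r j c'
  \<comment> \<open>Where no move reaches a won position the cops stay put, which keeps the strategy
    legal everywhere.\<close>
  define F where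
    "F c r = (if \<exists>j c'. Q c r j c' then SOME c'. Q c r (LEAST j. \<exists>c'. Q c r j c') c' else c)" for c r
  have F: "\<exists>i\<le>j. Q c r i (F c r)" if "Q c r j c'" for c r j c'
  proof -
    let ?i = "LEAST j. \<exists>c'. Q c r j c'"
    have "?i \<le> j"
      using that by (blast intro: Least_le)
    moreover have "\<exists>c'. Q c r ?i c'"
      using that by (rule_tac LeastI) blast
    then have "Q c r ?i (SOME c'. Q c r ?i c')"
      by (rule someI_ex)
    then have "Q c r ?i (F c r)"
      using that by (auto simp: F_def)
    ultimately show ?thesis by blast
  qed
  define s where "s h = F (fst (last h)) (snd (last h))" for h
  have "cop_move G c (F c r)" for c r
  proof (cases "\<exists>j c'. Q c r j c'")
    case True
    then show ?thesis using F by (auto simp: Q_def)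
  next
    case False
    then show ?thesis by (simp add: F_def cop_move_refl)
  qed
  then have "legal_strategy G k s"
    by (simp add: legal_strategy_def s_def)
  moreover have "\<not> escapes G C R" if play: "play_against G c\<^sub>0 s C R" for C R
  proof
    assume esc: "escapes G C R"
    have C_Suc: "C (Suc t) = F (C t) (R t)" for t
      using play by (simp add: play_against_def s_def)
    have R_Suc: "robber_move G (C (Suc t)) (R t) (R (Suc t))" for t
      using play unfolding play_against_def by blast
    have lost: "\<not> won_within G j (C (Suc t)) (R t)" for j t
    proof (induction j arbitrary: t rule: less_induct)
      case (less j)
      show ?case
      proof
        assume w: "won_within G j (C (Suc t)) (R t)"
        have ns: "\<not> surrounded G (C (Suc t)) (R t)"
          using esc by (simp add: escapes_def)
        \<comment> \<open>Rank 0 means surrounded, which an escaping play excludes.\<close>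
        obtain i where "j = Suc i"
          using w ns by (cases j) auto
        then obtain c' where "Q (C (Suc t)) (R (Suc t)) i c'"
          using w ns R_Suc[of t] by (auto simp: Q_def)
        then obtain l where "l \<le> i" "won_within G l (C (Suc (Suc t))) (R (Suc t))"
          using F by (metis C_Suc Q_def)
        with less \<open>j = Suc i\<close> show False
          by (meson le_imp_less_Suc)
      qed
    qed
    have "C 0 = c\<^sub>0" "R 0 \<in> pverts G - set c\<^sub>0"
      using play by (auto simp: play_against_def)
    then obtain c where "cop_move G (C 0) c" "won G c (R 0)"
      using won by blast
    then obtain j where "Q (C 0) (R 0) j c"
      using won_imp_won_within Q_def by blast
    then show False
      using F lost C_Suc by (metis Q_def)
  qed
  ultimately show ?thesis
    using c\<^sub>0 by (auto simp: cops_win_def winning_strategy_def)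
qed

section \<open>Strong products of two paths\<close>

abbreviation grid :: "nat \<Rightarrow> nat \<Rightarrow> (nat \<times> nat) pair_pre_digraph" where
  "grid m n \<equiv> path_graph m \<boxtimes> path_graph n"

lemma pair_graph_grid: "pair_graph (grid m n)"
  by (intro pair_graph_strong_product pair_graph_path_graph)

text \<open>This is a king's move on a chessboard, staying put included. Two inequalities per
  coordinate stand in for an absolute difference on the naturals.\<close>

fun near :: "nat \<times> nat \<Rightarrow> nat \<times> nat \<Rightarrow> bool" where
  "near (x, y) (x', y') \<longleftrightarrow> x \<le> Suc x' \<and> x' \<le> Suc x \<and> y \<le> Suc y' \<and> y' \<le> Suc y"

lemma pverts_grid: "pverts (grid m n) = {0..<m} \<times> {0..<n}"
  by (simp add: strong_product_def path_graph_def)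

lemma parcs_grid:
  "(u, v) \<in> parcs (grid m n) \<longleftrightarrow>
     u \<in> pverts (grid m n) \<and> v \<in> pverts (grid m n) \<and> u \<noteq> v \<and> near u v"
  by (cases u; cases v) (auto simp: strong_product_def path_graph_def)

lemma near_refl: "near u u"
  by (cases u) simp

lemma step_grid:
  "u \<in> pverts (grid m n) \<Longrightarrow> step (grid m n) u v \<longleftrightarrow> v \<in> pverts (grid m n) \<and> near u v"
  by (auto simp: step_def parcs_grid near_refl)

lemma cop_move_grid:
  "set c \<subseteq> pverts (grid m n) \<Longrightarrow> set c' \<subseteq> pverts (grid m n) \<Longrightarrow>
     cop_move (grid m n) c c' \<longleftrightarrow> list_all2 near c c'"
  unfolding cop_move_def by (intro list.rel_cong refl) (simp add: step_grid subsetD)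

text \<open>The conditions are confined to an explicit \<open>a\<close> by \<open>b\<close> corner
  of the grid so that they can be evaluated for all \<open>m\<close> and \<open>n\<close> at once;
  vertices outside the corner can only add neighbours. The bound \<open>l\<close> lets one
  evaluation serve every \<open>k\<close> \<le> \<open>l\<close>.\<close>

lemma grid_robber_escapes:
  assumes "a \<le> m" and "b \<le> n" and "k \<le> l"
    and "S \<noteq> []" and "distinct S"
    and "\<forall>v\<in>set S. fst v < a \<and> snd v < b \<and> l < length (filter (near v) S) \<and>
      l < length (filter (\<lambda>u. near v u \<and> u \<noteq> v) (List.product [0..<a] [0..<b]))"
  shows "\<not> cops_win (grid m n) k"
proof -
  interpret pair_graph "grid m n" by (rule pair_graph_grid)
  have sub: "set S \<subseteq> pverts (grid m n)"
    using assms by (auto simp: pverts_grid less_le_trans)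
  show ?thesis
  proof (rule robber_escapes[OF sub])
    fix v assume v: "v \<in> set S"
    then have V: "v \<in> pverts (grid m n)" using sub by blast
    have "{u \<in> set S. step (grid m n) v u} = set (filter (near v) S)"
      using sub V by (auto simp: step_grid)
    then have "card {u \<in> set S. step (grid m n) v u} = length (filter (near v) S)"
      using \<open>distinct S\<close> by (metis distinct_card distinct_filter)
    then show "k < card {u \<in> set S. step (grid m n) v u}"
      using assms v by fastforce
    let ?B = "filter (\<lambda>u. near v u \<and> u \<noteq> v) (List.product [0..<a] [0..<b])"
    have "set ?B \<subseteq> {u. (v, u) \<in> parcs (grid m n)}"
      using V assms by (auto simp: parcs_grid pverts_grid)
    moreover have "finite {u. (v, u) \<in> parcs (grid m n)}"
      by (rule finite_subset[of _ "pverts (grid m n)"]) (auto simp: parcs_grid pverts_grid)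
    ultimately have "card (set ?B) \<le> card {u. (v, u) \<in> parcs (grid m n)}"
      by (intro card_mono)
    moreover have "card (set ?B) = length ?B"
      by (intro distinct_card distinct_filter distinct_product) simp_all
    ultimately show "k < card {u. (v, u) \<in> parcs (grid m n)}"
      using assms v by fastforce
  qed (use assms in simp)
qed

section \<open>Chasing a moving target\<close>

definition toward :: "nat \<Rightarrow> nat \<Rightarrow> nat" where
  "toward a t = (if a < t then Suc a else if t < a then a - 1 else a)"

definition toward2 :: "nat \<times> nat \<Rightarrow> nat \<times> nat \<Rightarrow> nat \<times> nat" where
  "toward2 p q = (toward (fst p) (fst q), toward (snd p) (snd q))"

text \<open>
  A pursuer who is always one step behind its target at best keeps its side until it meets the
  target, so that after \<open>k\<close> rounds it has travelled \<open>k\<close> steps from the boundary or is on target.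
\<close>

definition closing :: "nat \<Rightarrow> nat \<Rightarrow> nat \<Rightarrow> nat \<Rightarrow> bool" where
  "closing k m a t \<longleftrightarrow> a = t \<or> k \<le> a \<and> a < t \<or> t < a \<and> a + k < m"

text \<open>The pursuer moves after seeing the new target. A target strictly on one side can at best
  step onto the pursuer's place, never past it, so the pursuer either meets it or gains one more
  step away from its boundary.\<close>

lemma closing_toward:
  "closing k m a t \<Longrightarrow> t \<le> Suc t' \<Longrightarrow> t' \<le> Suc t \<Longrightarrow> closing (Suc k) m (toward a t') t'"
  by (auto simp: closing_def toward_def)

definition closing2 :: "nat \<Rightarrow> nat \<Rightarrow> nat \<Rightarrow> nat \<times> nat \<Rightarrow> nat \<times> nat \<Rightarrow> bool" where
  "closing2 k m n p q \<longleftrightarrow> closing k m (fst p) (fst q) \<and> closing k n (snd p) (snd q)"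

text \<open>Each cop chases its own entry of \<open>T r\<close>, and \<open>m + n - j\<close> bounds
  the rounds until all have arrived. Since the targets move at most one step at a time, a cop that
  has arrived stays on target while the others catch up.\<close>

lemma won_by_tracking:
  assumes T: "\<And>r. r \<in> pverts (grid m n) \<Longrightarrow> T r \<in> cop_positions (grid m n) k"
    and near_T: "\<And>r r'. r \<in> pverts (grid m n) \<Longrightarrow> r' \<in> pverts (grid m n) \<Longrightarrow> near r r' \<Longrightarrow>
      list_all2 near (T r) (T r')"
    and won_T: "\<And>r. r \<in> pverts (grid m n) \<Longrightarrow> won (grid m n) (T r) r"
    and "c \<in> cop_positions (grid m n) k" and "r \<in> pverts (grid m n)"
    and "list_all2 (closing2 j m n) c (T r)"
  shows "won (grid m n) c r"
  using assms(4-6)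
proof (induction "m + n - j" arbitrary: j c r)
  case 0
  \<comment> \<open>Now \<open>j\<close> is at least \<open>m + n\<close>, and neither strict
    alternative of \<open>closing\<close> fits inside the grid.\<close>
  have "closing2 j m n p q \<longrightarrow> p = q" if "q \<in> set (T r)" for p q
    using 0(1) T[OF 0(3)] that
    by (cases p; cases q) (auto simp: closing2_def closing_def cop_positions_def pverts_grid)
  then have "list_all2 (=) c (T r)"
    using 0(4) by (auto simp: list_all2_conv_all_nth)
  then show ?case
    using won_T[OF 0(3)] by (simp add: list.rel_eq)
next
  case (Suc i)
  show ?case
  proof (rule won.reply)
    fix r' assume "robber_move (grid m n) c r r'"
    then have r': "r' \<in> pverts (grid m n)" "near r r'"
      using Suc.prems(2) by (auto simp: robber_move_def step_grid)
    define c' where "c' = map2 toward2 c (T r')"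
    have len: "length c = k" "length (T r) = k" "length (T r') = k"
      using Suc.prems(1) T Suc.prems(2) r'(1) by (auto simp: cop_positions_def)
    have cV: "c ! l \<in> {0..<m} \<times> {0..<n}" "T r' ! l \<in> {0..<m} \<times> {0..<n}" if "l < k" for l
      using Suc.prems(1) T[OF r'(1)] that by (auto simp: cop_positions_def pverts_grid)
    have c'_nth: "c' ! l = toward2 (c ! l) (T r' ! l)" if "l < k" for l
      using that len by (simp add: c'_def)
    have "toward2 p q \<in> {0..<m} \<times> {0..<n} \<and> near p (toward2 p q)"
      if "p \<in> {0..<m} \<times> {0..<n}" "q \<in> {0..<m} \<times> {0..<n}" for p q
      using that by (auto simp: toward2_def toward_def)
    then have c': "c' ! l \<in> pverts (grid m n)" "near (c ! l) (c' ! l)" if "l < k" for l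
      using cV[OF that] c'_nth[OF that] by (auto simp: pverts_grid)
    have lenc': "length c' = k"
      using len by (simp add: c'_def)
    have "set c' \<subseteq> pverts (grid m n)"
    proof
      fix p assume "p \<in> set c'"
      then obtain l where "l < k" "p = c' ! l"
        unfolding in_set_conv_nth lenc' by blast
      then show "p \<in> pverts (grid m n)"
        using c'(1) by simp
    qed
    then have pos: "c' \<in> cop_positions (grid m n) k"
      using lenc' by (simp add: cop_positions_def)
    have "cop_move (grid m n) c c'"
      using c'(2) lenc' len pos Suc.prems(1)
      by (subst cop_move_grid) (simp_all add: cop_positions_def list_all2_conv_all_nth)
    moreover have "closing2 (Suc j) m n (c' ! l) (T r' ! l)" if "l < k" for l
    proof -
      have "near (T r ! l) (T r' ! l)" "closing2 j m n (c ! l) (T r ! l)"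
        using near_T[OF Suc.prems(2) r'] Suc.prems(3) that len by (auto simp: list_all2_conv_all_nth)
      then show ?thesis
        using c'_nth[OF that]
        by (cases "T r ! l"; cases "T r' ! l")
          (auto simp: closing2_def toward2_def intro: closing_toward)
    qed
    then have "list_all2 (closing2 (Suc j) m n) c' (T r')"
      using len lenc' by (simp add: list_all2_conv_all_nth)
    then have "won (grid m n) c' r'"
      using Suc.hyps(2) by (intro Suc.hyps(1)[of "Suc j"] pos r') auto
    ultimately show "\<exists>c'. cop_move (grid m n) c c' \<and> won (grid m n) c' r'"
      by blast
  qed
qed

lemma cops_win_by_tracking:
  assumes T: "\<And>r. r \<in> pverts (grid m n) \<Longrightarrow> T r \<in> cop_positions (grid m n) k"
    and near_T: "\<And>r r'. r \<in> pverts (grid m n) \<Longrightarrow> r' \<in> pverts (grid m n) \<Longrightarrow> near r r' \<Longrightarrow>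
      list_all2 near (T r) (T r')"
    and won_T: "\<And>r. r \<in> pverts (grid m n) \<Longrightarrow> won (grid m n) (T r) r"
    and "0 < m" and "0 < n"
  shows "cops_win (grid m n) k"
proof (rule pair_graph.cops_winI[OF pair_graph_grid])
  have zero: "(0, 0) \<in> pverts (grid m n)"
    using assms by (simp add: pverts_grid)
  show T0: "T (0, 0) \<in> cop_positions (grid m n) k"
    by (rule T[OF zero])
  fix r assume r: "r \<in> pverts (grid m n) - set (T (0, 0))"
  have "closing2 0 m n p q" if "p \<in> pverts (grid m n)" "q \<in> pverts (grid m n)" for p q
    using that by (cases p; cases q) (auto simp: closing2_def closing_def pverts_grid)
  then have "list_all2 (closing2 0 m n) (T (0, 0)) (T r)"
    using T0 T[of r] r unfolding cop_positions_def list_all2_conv_all_nth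
    by (simp add: subset_iff del: split_paired_All)
  then have "won (grid m n) (T (0, 0)) r"
    by (rule won_by_tracking[OF T near_T won_T T0, rotated -1]) (use r in auto)
  \<comment> \<open>The cops spend their opening move standing still; \<open>won\<close> then has
    the robber to move.\<close>
  then show "\<exists>c. cop_move (grid m n) (T (0, 0)) c \<and> won (grid m n) c r"
    using cop_move_refl by blast
qed

text \<open>Once in formation the cops keep it after every robber move, so his vertices descend
  along \<open>D\<close>. The induction bottoms out at a robber without legal moves, where
  \<open>won.reply\<close> holds vacuously.\<close>

lemma cops_win_by_descent:
  fixes T :: "nat \<times> nat \<Rightarrow> (nat \<times> nat) list"
  assumes T: "\<And>r. r \<in> pverts (grid m n) \<Longrightarrow> T r \<in> cop_positions (grid m n) k"
    and near_T: "\<And>r r'. r \<in> pverts (grid m n) \<Longrightarrow> r' \<in> pverts (grid m n) \<Longrightarrow> near r r' \<Longrightarrow>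
      list_all2 near (T r) (T r')"
    and descent: "\<And>r r'. r \<in> pverts (grid m n) \<Longrightarrow> r' \<in> pverts (grid m n) \<Longrightarrow> near r r' \<Longrightarrow>
      r' \<notin> set (T r) \<Longrightarrow> (r', r) \<in> D"
    and "wf D" and "0 < m" and "0 < n"
  shows "cops_win (grid m n) k"
proof (rule cops_win_by_tracking[OF T near_T])
  fix r assume "r \<in> pverts (grid m n)"
  with \<open>wf D\<close> show "won (grid m n) (T r) r"
  proof (induction r rule: wf_induct_rule)
    case (less r)
    show ?case
    proof (rule won.reply)
      fix r' assume "robber_move (grid m n) (T r) r r'"
      then have r': "r' \<in> pverts (grid m n)" "near r r'" "r' \<notin> set (T r)"
        using less.prems by (auto simp: robber_move_def step_grid)
      have "cop_move (grid m n) (T r) (T r')"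
        using T near_T less.prems r' by (subst cop_move_grid) (auto simp: cop_positions_def)
      moreover have "won (grid m n) (T r') r'"
        using less r' descent by blast
      ultimately show "\<exists>c'. cop_move (grid m n) (T r) c' \<and> won (grid m n) c' r'"
        by blast
    qed
  qed
qed (use assms in auto)

section \<open>Cop strategies\<close>

lemma min_Suc_le: "x \<le> Suc x' \<Longrightarrow> min (Suc x) l \<le> Suc (min (Suc x') l)" for x x' l :: nat
  by auto

lemma cops_win_5:
  assumes "0 < m" and "0 < n"
  shows "cops_win (grid m n) 5"
proof -
  define X where "X x = min (Suc x) (m - 1)" for x
  define Y where "Y y = min (Suc y) (n - 1)" for y
  \<comment> \<open>Clamping never increases distances, so the formation can follow the robber.
    Truncated subtraction in \<open>y - 1\<close> is the clamp at the lower edge.\<close>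
  define T where
    "T r = (case r of (x, y) \<Rightarrow> [(x, y), (X x, Y y), (X x, y), (X x, y - 1), (x, Y y)])" for r
  have XY: "X x < m" "Y y < n" for x y
    using assms by (auto simp: X_def Y_def)
  have near_X: "X x \<le> Suc (X x')" if "x \<le> Suc x'" for x x'
    using that unfolding X_def by (rule min_Suc_le)
  have near_Y: "Y y \<le> Suc (Y y')" if "y \<le> Suc y'" for y y'
    using that unfolding Y_def by (rule min_Suc_le)
  show ?thesis
  proof (rule cops_win_by_descent[where T = T and D = "less_than <*lex*> less_than"])
    show "T r \<in> cop_positions (grid m n) 5" if "r \<in> pverts (grid m n)" for r
      using that XY by (cases r) (auto simp: T_def cop_positions_def pverts_grid)
    show "list_all2 near (T r) (T r')" if "near r r'" for r r'
      using that near_X near_Y by (cases r; cases r') (auto simp: T_def)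
    show "(r', r) \<in> less_than <*lex*> less_than"
      if "r \<in> pverts (grid m n)" and "r' \<in> pverts (grid m n)" and "near r r'"
        and "r' \<notin> set (T r)" for r r'
    proof -
      obtain x y x' y' where r: "r = (x, y)" "r' = (x', y')"
        by (cases r; cases r')
      have bounds: "x' < m" "y' < n" and "near (x, y) (x', y')"
        using that r by (auto simp: pverts_grid)
      then have "x' = Suc x \<or> x' = x \<or> x' < x" "y' = Suc y \<or> y' = y \<or> y' = y - 1 \<and> y' < y"
        by auto
      moreover have "X x = Suc x" if "x' = Suc x"
        using that bounds by (simp add: X_def)
      moreover have "Y y = Suc y" if "y' = Suc y"
        using that bounds by (simp add: Y_def)
      ultimately show ?thesis
        using \<open>r' \<notin> set (T r)\<close> r by (auto simp: T_def)
    qed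
  qed (use assms in auto)
qed

lemma cops_win_2_4:
  assumes "0 < n"
  shows "cops_win (grid 2 n) 4"
proof -
  define Y where "Y y = min (Suc y) (n - 1)" for y
  define T :: "nat \<times> nat \<Rightarrow> (nat \<times> nat) list" where
    "T r = (case r of (x, y) \<Rightarrow> [(0, y), (1, y), (0, Y y), (1, Y y)])" for r
  have Y: "Y y < n" for y
    using assms by (auto simp: Y_def)
  have near_Y: "Y y \<le> Suc (Y y')" if "y \<le> Suc y'" for y y'
    using that unfolding Y_def by (rule min_Suc_le)
  show ?thesis
  proof (rule cops_win_by_descent[where T = T and D = "measure snd"])
    show "T r \<in> cop_positions (grid 2 n) 4" if "r \<in> pverts (grid 2 n)" for r
      using that Y by (cases r) (auto simp: T_def cop_positions_def pverts_grid)
    show "list_all2 near (T r) (T r')" if "near r r'" for r r'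
      using that near_Y by (cases r; cases r') (auto simp: T_def)
    show "(r', r) \<in> measure snd"
      if "r \<in> pverts (grid 2 n)" and "r' \<in> pverts (grid 2 n)" and "near r r'"
        and "r' \<notin> set (T r)" for r r'
    proof -
      obtain x y x' y' where r: "r = (x, y)" "r' = (x', y')"
        by (cases r; cases r')
      have bounds: "x' < 2" "y' < n" and "near (x, y) (x', y')"
        using that r by (auto simp: pverts_grid)
      then have "x' = 0 \<or> x' = 1" "y' = Suc y \<or> y' = y \<or> y' < y"
        by auto
      moreover have "Y y = Suc y" if "y' = Suc y"
        using that bounds by (simp add: Y_def)
      ultimately show ?thesis
        using \<open>r' \<notin> set (T r)\<close> r by (auto simp: T_def)
    qed
  qed (use assms in auto)
qed

text \<open>The formation alone does not force a descent, as the robber may stay in his row at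
  either side of the middle cop. The induction on his row therefore allows two rounds, with the cops
  briefly out of formation.\<close>

lemma cops_win_3_4:
  assumes "0 < n"
  shows "cops_win (grid 3 n) 4"
proof -
  define T :: "nat \<times> nat \<Rightarrow> (nat \<times> nat) list" where
    "T r = (let y = snd r; z = min (Suc y) (n - 1) in [(0, z), (1, z), (2, z), (1, y)])" for r
  have T: "T r \<in> cop_positions (grid 3 n) 4" if "r \<in> pverts (grid 3 n)" for r
    using that by (auto simp: T_def Let_def cop_positions_def pverts_grid)
  have near_T: "list_all2 near (T r) (T r')" if "near r r'" for r r'
    using that by (cases r; cases r') (auto simp: T_def Let_def)
  have "won (grid 3 n) (T r) r" if "r \<in> pverts (grid 3 n)" for r
    using that
  proof (induction "snd r" arbitrary: r rule: less_induct)
    case less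
    obtain x y where r: "r = (x, y)" "x < 3" "y < n"
      using less.prems by (auto simp: pverts_grid)
    show ?case
    proof (rule won.reply)
      fix r' assume "robber_move (grid 3 n) (T r) r r'"
      then have r': "r' \<in> pverts (grid 3 n)" "near r r'" "r' \<notin> set (T r)"
        using less.prems by (auto simp: robber_move_def step_grid)
      then obtain x' y' where r'_eq: "r' = (x', y')" "x' < 3" "y' < n"
        by (auto simp: pverts_grid)
      have "x' \<in> {0, 1, 2}"
        using r'_eq by auto
      \<comment> \<open>On the last row \<open>z\<close> equals \<open>y\<close>, so the barrier
        fills the robber's own row and he can only go down; waiting is possible on lower rows
        only.\<close>
      then have "y' < y \<or> y' = y \<and> Suc y < n"
        using r' r r'_eq by (auto simp: T_def Let_def min_def split: if_splits)
      then show "\<exists>c'. cop_move (grid 3 n) (T r) c' \<and> won (grid 3 n) c' r'"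
      proof
        assume "y' < y"
        then have "won (grid 3 n) (T r') r'"
          using less r r' r'_eq by auto
        moreover have "cop_move (grid 3 n) (T r) (T r')"
          using T less.prems r' near_T by (subst cop_move_grid) (auto simp: cop_positions_def)
        ultimately show ?thesis by blast
      next
        \<comment> \<open>The robber waits beside the middle cop. The middle cop steps onto him and the barrier cop
          on the far side, which guards none of his neighbours, fills the vacancy; this drives him
          to the row below, and all four cops are then one step from their posts.\<close>
        assume y': "y' = y \<and> Suc y < n"
        let ?c = "if x' = 0 then [(0, Suc y), (1, Suc y), (1, y), (0, y)]
          else [(1, y), (1, Suc y), (2, Suc y), (2, y)]"
        have x': "x' = 0 \<or> x' = 2"
          using \<open>x' \<in> {0, 1, 2}\<close> r' r r'_eq y' by (auto simp: T_def Let_def)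
        have c: "set ?c \<subseteq> pverts (grid 3 n)"
          using y' by (auto simp: pverts_grid)
        have "list_all2 near (T r) ?c"
          using r y' by (auto simp: T_def Let_def)
        then have "cop_move (grid 3 n) (T r) ?c"
          using T[OF less.prems] c by (subst cop_move_grid) (auto simp: cop_positions_def)
        moreover have "won (grid 3 n) ?c r'"
        proof (rule won.reply)
          fix r'' assume "robber_move (grid 3 n) ?c r' r''"
          then have r'': "r'' \<in> pverts (grid 3 n)" "near r' r''" "r'' \<notin> set ?c"
            using r' by (auto simp: robber_move_def step_grid)
          then obtain x'' y'' where r''_eq: "r'' = (x'', y'')" "x'' < 3" "y'' < n"
            by (auto simp: pverts_grid)
          have "x'' \<in> {0, 1, 2}" "y'' = y - 1 \<or> y'' = y \<or> y'' = Suc y"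
            using r''_eq r'' r'_eq y' by auto
          \<comment> \<open>If \<open>y\<close> is 0 there is no row below and no legal move is
            left, so the assumed move is contradictory.\<close>
          then have y'': "y = Suc y''"
            using r'' r'_eq r''_eq x' y' by (cases y) (auto split: if_splits)
          have "list_all2 near ?c (T r'')"
            using r''_eq y' y'' by (auto simp: T_def Let_def)
          then have "cop_move (grid 3 n) ?c (T r'')"
            using T[OF r''(1)] c by (subst cop_move_grid) (auto simp: cop_positions_def)
          moreover have "won (grid 3 n) (T r'') r''"
            using less(1)[of r''] r r'' r''_eq y'' by simp
          ultimately show "\<exists>c'. cop_move (grid 3 n) ?c c' \<and> won (grid 3 n) c' r''"
            by blast
        qed
        ultimately show ?thesis by blast
      qed
    qed
  qed
  then show ?thesis
    by (intro cops_win_by_tracking[where T = T] T near_T) (use assms in auto)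
qed

text \<open>With row 1 full and at most three rows, the robber starts in a corner whose only free
  neighbour is \<open>(1 - x, y)\<close>. The spare cop on row 1 reaches it in one move.\<close>

lemma cops_win_2_3:
  assumes "n = 2 \<or> n = 3"
  shows "cops_win (grid 2 n) 3"
proof (rule pair_graph.cops_winI[OF pair_graph_grid])
  let ?c = "[(0, 1), (1, 1), (0, 1)] :: (nat \<times> nat) list"
  show "?c \<in> cop_positions (grid 2 n) 3"
    using assms by (auto simp: cop_positions_def pverts_grid)
  fix r assume "r \<in> pverts (grid 2 n) - set ?c"
  then obtain x y where r: "r = (x, y)" "x = 0 \<or> x = 1" "y = 0 \<or> y = 2" "y < n"
    using assms by (cases r) (auto simp: pverts_grid less_2_cases_iff less_Suc_eq numeral_eq_Suc)
  let ?c' = "[(0, 1), (1, 1), (1 - x, y)]"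
  have "cop_move (grid 2 n) ?c ?c'"
    using assms r by (subst cop_move_grid) (auto simp: pverts_grid)
  moreover have "surrounded (grid 2 n) ?c' r"
    using assms r by (auto simp: surrounded_def parcs_grid pverts_grid)
  ultimately show "\<exists>c'. cop_move (grid 2 n) ?c c' \<and> won (grid 2 n) c' r"
    by (intro exI conjI won.surrounded)
qed

section \<open>The values of the surrounding cop number\<close>

lemma surrounding_cop_number_eqI:
  assumes "1 \<le> k" and "cops_win G k" and "\<And>j. j < k \<Longrightarrow> \<not> cops_win G j"
  shows "\<sigma> G = k"
  unfolding surrounding_cop_number_def
proof (rule Least_equality)
  show "1 \<le> k \<and> cops_win G k"
    using assms by simp
  show "k \<le> j" if "1 \<le> j \<and> cops_win G j" for j
    using assms(3)[of j] that by linarith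
qed

theorem theorem18:
  fixes m n :: nat
  assumes "2 \<le> m" and "m \<le> n"
  shows "(4 \<le> m \<longrightarrow> \<sigma> (path_graph m \<boxtimes> path_graph n) = 5) \<and>
    (m = 3 \<or> (m = 2 \<and> 4 \<le> n) \<longrightarrow> \<sigma> (path_graph m \<boxtimes> path_graph n) = 4) \<and>
    (m = 2 \<and> n \<le> 3 \<longrightarrow> \<sigma> (path_graph m \<boxtimes> path_graph n) = 3)"
proof (intro conjI impI)
  assume m: "4 \<le> m"
  show "\<sigma> (grid m n) = 5"
  proof (rule surrounding_cop_number_eqI)
    fix j :: nat assume "j < 5"
    \<comment> \<open>The robber uses the 4 by 4 square without its corners, which may have only
      three neighbours.\<close>
    then show "\<not> cops_win (grid m n) j"
      using assms m
      by (intro grid_robber_escapes[of 4 _ 4 _ _ 4 "[(0, 1), (0, 2), (1, 0), (1, 1), (1, 2), (1, 3),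
            (2, 0), (2, 1), (2, 2), (2, 3), (3, 1), (3, 2)]"]) (simp_all add: upt_rec)
  qed (use assms in \<open>auto intro: cops_win_5\<close>)
next
  assume "m = 3 \<or> m = 2 \<and> 4 \<le> n"
  then show "\<sigma> (grid m n) = 4"
  proof
    assume m: "m = 3"
    show ?thesis
    proof (rule surrounding_cop_number_eqI)
      fix j :: nat assume "j < 4"
      \<comment> \<open>The robber uses the plus shape in the 3 by 3 square, again avoiding
        corners.\<close>
      then show "\<not> cops_win (grid m n) j"
        using assms m
        by (intro grid_robber_escapes[of 3 _ 3 _ _ 3 "[(0, 1), (1, 0), (1, 1), (1, 2), (2, 1)]"])
          (simp_all add: upt_rec)
    qed (use assms m in \<open>auto intro: cops_win_3_4\<close>)
  next
    assume m: "m = 2 \<and> 4 \<le> n"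
    show ?thesis
    proof (rule surrounding_cop_number_eqI)
      fix j :: nat assume "j < 4"
      \<comment> \<open>The robber uses the two middle rows of the 2 by 4 corner, a clique of four
        vertices of degree 5.\<close>
      then show "\<not> cops_win (grid m n) j"
        using assms m
        by (intro grid_robber_escapes[of 2 _ 4 _ _ 3 "[(0, 1), (0, 2), (1, 1), (1, 2)]"])
          (simp_all add: upt_rec)
    qed (use assms m in \<open>auto intro: cops_win_2_4\<close>)
  qed
next
  assume m: "m = 2 \<and> n \<le> 3"
  show "\<sigma> (grid m n) = 3"
  proof (rule surrounding_cop_number_eqI)
    fix j :: nat assume "j < 3"
    \<comment> \<open>Any 2 by 2 block is a clique, so each of its vertices has three neighbours
      within it.\<close>
    then show "\<not> cops_win (grid m n) j"
      using assms m
      by (intro grid_robber_escapes[of 2 _ 2 _ _ 2 "[(0, 0), (0, 1), (1, 0), (1, 1)]"])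
        (simp_all add: upt_rec)
  next
    show "cops_win (grid m n) 3"
      using assms m by (auto intro!: cops_win_2_3)
  qed simp
qed

end
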